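(* Let $(X,d_X)$, $(Y,d_Y)$ be Polish spaces, $c:X\times Y\to\mathbb{R}$ a bounded Borel cost, $\rho_1\in\mathcal{P}(X)$, $\rho_2\in\mathcal{P}(Y)$ probability measures and $\varepsilon>0$. Then the supremum $$\sup\left\{ D_{\varepsilon}(u,v) \; : \; u\in L^{\exp}_{\varepsilon}(\rho_1),\ v\in L^{\exp}_{\varepsilon}(\rho_2)\right\}$$ is attained at a couple $(u_0,v_0)$, which is unique ($\rho_1$-a.e. and $\rho_2$-a.e. respectively) up to the trivial transformation $(u,v)\mapsto(u+a,v-a)$, $a\in\mathbb{R}$. Moreover $u_0\in L^{\infty}(\rho_1)$ and $v_0\in L^{\infty}(\rho_2)$, and the maximizers can be chosen such that $\|u_0\|_{\infty},\|v_0\|_{\infty}\le \frac32\|c\|_{\infty}$.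
   Context: $\mathcal{P}(X)$ denotes the Borel probability measures on $X$; $\|c\|_\infty=\sup|c|$. For $\varepsilon>0$ and a probability measure $\rho$ on a Polish space $X$, $L^{\exp}_{\varepsilon}(\rho)$ is the set of measurable functions $u:X\to[-\infty,\infty)$ with $0<\int_X e^{u/\varepsilon}\,d\rho<\infty$ (with $e^{-\infty}=0$). For such $u$ the positive part $u^+$ is in $L^1(\rho)$, so $\int u\,d\rho\in[-\infty,\infty)$ is well defined. For $u\in L^{\exp}_{\varepsilon}(\rho_1)$, $v\in L^{\exp}_{\varepsilon}(\rho_2)$ the Entropy-Kantorovich functional is $$D_{\varepsilon}(u,v)=\int_X u\,d\rho_1+\int_Y v\,d\rho_2-\varepsilon\int_{X\times Y}e^{\frac{u(x)+v(y)-c(x,y)}{\varepsilon}}\,d(\rho_1\otimes\rho_2)\in[-\infty,\infty).$$ *)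

theory Defs
  imports "HOL-Probability.Probability"
begin

definition ereal_exp :: "ereal \<Rightarrow> ennreal" where
  "ereal_exp x = (case x of ereal r \<Rightarrow> ennreal (exp r) | PInfty \<Rightarrow> \<infinity> | MInfty \<Rightarrow> 0)"

lemma ereal_exp_simps [simp]:
  "ereal_exp (ereal r) = ennreal (exp r)"
  "ereal_exp \<infinity> = \<infinity>"
  "ereal_exp (- \<infinity>) = 0"
  by (simp_all add: ereal_exp_def)

(* e2ennreal truncates negative values to 0, so this is the integral of the positive part minus
   the integral of the negative part. On L_exp below the first term is finite, so that
   the ill-defined difference of two infinities does not occur. *)
definition ereal_integral :: "'a measure \<Rightarrow> ('a \<Rightarrow> ereal) \<Rightarrow> ereal" where
  "ereal_integral M u =
     enn2ereal (\<integral>\<^sup>+x. e2ennreal (u x) \<partial>M) - enn2ereal (\<integral>\<^sup>+x. e2ennreal (- u x) \<partial>M)"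

definition L_exp :: "real \<Rightarrow> 'a measure \<Rightarrow> ('a \<Rightarrow> ereal) set" where
  "L_exp \<epsilon> \<rho> = {u \<in> borel_measurable \<rho>.
     (\<forall>x\<in>space \<rho>. u x < \<infinity>) \<and>
     0 < (\<integral>\<^sup>+x. ereal_exp (u x / ereal \<epsilon>) \<partial>\<rho>) \<and>
     (\<integral>\<^sup>+x. ereal_exp (u x / ereal \<epsilon>) \<partial>\<rho>) < \<infinity>}"

definition EK_functional ::
  "('a \<times> 'b \<Rightarrow> real) \<Rightarrow> 'a measure \<Rightarrow> 'b measure \<Rightarrow> real \<Rightarrow>
     ('a \<Rightarrow> ereal) \<Rightarrow> ('b \<Rightarrow> ereal) \<Rightarrow> ereal" where
  "EK_functional c \<rho>\<^sub>1 \<rho>\<^sub>2 \<epsilon> u v =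
     ereal_integral \<rho>\<^sub>1 u + ereal_integral \<rho>\<^sub>2 v
       - ereal \<epsilon> * enn2ereal
           (\<integral>\<^sup>+z. ereal_exp ((u (fst z) + v (snd z) - ereal (c z)) / ereal \<epsilon>) \<partial>(\<rho>\<^sub>1 \<Otimes>\<^sub>M \<rho>\<^sub>2))"

definition EK_maximizer ::
  "('a \<times> 'b \<Rightarrow> real) \<Rightarrow> 'a measure \<Rightarrow> 'b measure \<Rightarrow> real \<Rightarrow>
     ('a \<Rightarrow> ereal) \<Rightarrow> ('b \<Rightarrow> ereal) \<Rightarrow> bool" where
  "EK_maximizer c \<rho>\<^sub>1 \<rho>\<^sub>2 \<epsilon> u\<^sub>0 v\<^sub>0 \<longleftrightarrow>
     u\<^sub>0 \<in> L_exp \<epsilon> \<rho>\<^sub>1 \<and> v\<^sub>0 \<in> L_exp \<epsilon> \<rho>\<^sub>2 \<and>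
     EK_functional c \<rho>\<^sub>1 \<rho>\<^sub>2 \<epsilon> u\<^sub>0 v\<^sub>0 =
       (SUP (u, v) \<in> L_exp \<epsilon> \<rho>\<^sub>1 \<times> L_exp \<epsilon> \<rho>\<^sub>2. EK_functional c \<rho>\<^sub>1 \<rho>\<^sub>2 \<epsilon> u v)"

definition L_infinity :: "'a measure \<Rightarrow> ('a \<Rightarrow> ereal) set" where
  "L_infinity M = {f \<in> borel_measurable M. esssup M (\<lambda>x. \<bar>f x\<bar>) < \<infinity>}"

definition sup_norm :: "('a \<Rightarrow> ereal) \<Rightarrow> ereal" where
  "sup_norm f = (SUP x. \<bar>f x\<bar>)"

end

theory Submission
  imports Defs
begin

text \<open>Maximizers correspond to solutions of the Schroedinger system: \<open>p = exp ((u + v - c) / \<epsilon>)\<close> has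
  both conditional integrals equal to 1. In multiplicative form, with \<open>f = exp (u / \<epsilon>)\<close>,
  \<open>g = exp (v / \<epsilon>)\<close> and \<open>k = exp (- c / \<epsilon>)\<close>, this reads \<open>f = 1 / \<integral> k g\<close>, \<open>g = 1 / \<integral> k f\<close>.
  As \<open>c\<close> is bounded, \<open>k\<close> is bounded above and away from 0, so the Sinkhorn iteration contracts
  the oscillation of \<open>ln g\<close> (Hilbert's projective metric) and converges to a solution. Distributing
  the free constant evenly between \<open>u\<close> and \<open>v\<close> gives the bound \<open>3/2\<close> times the norm of \<open>c\<close>.
  Integrating \<open>e\<^sup>t \<ge> 1 + t\<close> against \<open>p\<close> shows that this solution is optimal, and the equality case
  \<open>t = 0\<close> forces any other maximizer to differ from it by a constant shift.\<close>

section \<open>Functions and kernels bounded above and away from zero\<close>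

definition pos_bdd :: "'a measure \<Rightarrow> ('a \<Rightarrow> real) \<Rightarrow> bool" where
  "pos_bdd M g \<longleftrightarrow> g \<in> borel_measurable M \<and> (\<exists>b>0. \<forall>x. 1 / b \<le> g x \<and> g x \<le> b)"

lemma pos_bddI:
  assumes "g \<in> borel_measurable M" "0 < a" "\<And>x. a \<le> g x" "\<And>x. g x \<le> b"
  shows "pos_bdd M g"
proof -
  have *: "0 < max b (1 / a)" using assms(2) by (simp add: less_max_iff_disj)
  with this have "1 / max b (1 / a) \<le> a"
    using assms(2) by (simp add: divide_le_eq mult.commute[of a]) (simp add: max_def field_simps)
  then show ?thesis
    using assms * unfolding pos_bdd_def
    by (intro conjI exI[of _ "max b (1 / a)"]) (auto intro: order_trans simp: le_max_iff_disj)
qed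

lemma pos_bdd_pos: "pos_bdd M g \<Longrightarrow> 0 < g x"
  unfolding pos_bdd_def by (metis less_le_trans zero_less_divide_1_iff)

lemma pos_bdd_measurable: "pos_bdd M g \<Longrightarrow> g \<in> borel_measurable M"
  unfolding pos_bdd_def by blast

text \<open>Only the variable that is integrated carries a measure; the other is a bare parameter.
  The locale thus fits both a kernel and its transpose, which drive the two half-steps of the
  Sinkhorn iteration.\<close>

locale bounded_kernel = prob_space N for N :: "'b measure" +
  fixes k :: "'a \<Rightarrow> 'b \<Rightarrow> real" and B :: real
  assumes kernel_measurable [measurable]: "\<And>x. k x \<in> borel_measurable N"
    and B_ge_1: "1 \<le> B"
    and kernel_lower: "\<And>x y. 1 / B \<le> k x y"
    and kernel_upper: "\<And>x y. k x y \<le> B"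
begin

lemma kernel_pos: "0 < k x y"
  using kernel_lower[of x y] B_ge_1 by (smt (verit) divide_pos_pos)

lemma kernel_compare: "k x y \<le> B\<^sup>2 * k x' y'"
proof -
  have "B = B\<^sup>2 * (1 / B)" using B_ge_1 by (simp add: power2_eq_square)
  also have "\<dots> \<le> B\<^sup>2 * k x' y'" using kernel_lower by (intro mult_left_mono) auto
  finally show ?thesis using kernel_upper[of x y] by linarith
qed

definition kint :: "('b \<Rightarrow> real) \<Rightarrow> 'a \<Rightarrow> real" where
  "kint g x = (\<integral>y. k x y * g y \<partial>N)"

lemma integrable_pos_bdd: "pos_bdd N g \<Longrightarrow> integrable N g"
proof -
  assume g: "pos_bdd N g"
  then obtain b where "\<And>x. g x \<le> b" by (auto simp: pos_bdd_def)
  then show ?thesis using pos_bdd_pos[OF g] pos_bdd_measurable[OF g]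
    by (intro integrable_const_bound[of _ b]) (auto simp: less_imp_le)
qed

lemma integrable_kernel_mult:
  assumes g: "pos_bdd N g"
  shows "integrable N (\<lambda>y. k x y * g y)"
proof (rule Bochner_Integration.integrable_bound)
  show "integrable N (\<lambda>y. B * g y)" using integrable_pos_bdd[OF g] by simp
  show "(\<lambda>y. k x y * g y) \<in> borel_measurable N" using pos_bdd_measurable[OF g] by measurable
  show "AE y in N. norm (k x y * g y) \<le> norm (B * g y)"
    using kernel_pos kernel_upper pos_bdd_pos[OF g] B_ge_1
    by (auto simp: abs_mult less_imp_le intro!: mult_right_mono)
qed

lemma integral_pos_bdd_pos:
  assumes g: "pos_bdd N g"
  shows "0 < (\<integral>y. g y \<partial>N)"
proof -
  obtain b where b: "b > 0" "\<And>x. 1 / b \<le> g x" using g by (auto simp: pos_bdd_def)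
  have "1 / b = (\<integral>y. 1 / b \<partial>N)" by (simp add: prob_space)
  also have "\<dots> \<le> (\<integral>y. g y \<partial>N)" using b integrable_pos_bdd[OF g] by (intro integral_mono) auto
  finally show ?thesis using b(1) by (smt (verit) divide_pos_pos)
qed

lemma kint_lower:
  assumes g: "pos_bdd N g"
  shows "(\<integral>y. g y \<partial>N) / B \<le> kint g x"
proof -
  have "(\<integral>y. g y \<partial>N) / B = (\<integral>y. 1 / B * g y \<partial>N)" by simp
  also have "\<dots> \<le> kint g x" unfolding kint_def
    using integrable_pos_bdd[OF g] integrable_kernel_mult[OF g] kernel_lower pos_bdd_pos[OF g]
    by (intro integral_mono mult_right_mono) (auto simp: less_imp_le)
  finally show ?thesis .
qed

lemma kint_upper:
  assumes g: "pos_bdd N g"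
  shows "kint g x \<le> B * (\<integral>y. g y \<partial>N)"
proof -
  have "kint g x \<le> (\<integral>y. B * g y \<partial>N)" unfolding kint_def
    using integrable_pos_bdd[OF g] integrable_kernel_mult[OF g] kernel_upper pos_bdd_pos[OF g]
    by (intro integral_mono mult_right_mono) (auto simp: less_imp_le)
  then show ?thesis by simp
qed

lemma kint_pos: "pos_bdd N g \<Longrightarrow> 0 < kint g x"
  using kint_lower[of g x] integral_pos_bdd_pos[of g] B_ge_1
  by (smt (verit) divide_pos_pos)

text \<open>The pointwise comparison of two kernel rows survives integration. Unlike the bounds in
  \<open>kint_lower\<close> and \<open>kint_upper\<close>, the factor does not involve the mass of
  \<open>g\<close>.\<close>

lemma kint_compare:
  assumes g: "pos_bdd N g"
  shows "kint g x \<le> B\<^sup>2 * kint g x'"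
proof -
  have "kint g x \<le> (\<integral>y. B\<^sup>2 * (k x' y * g y) \<partial>N)" unfolding kint_def
  proof (intro integral_mono)
    show "k x y * g y \<le> B\<^sup>2 * (k x' y * g y)" for y
      using mult_right_mono[OF kernel_compare[of x y x' y], of "g y"] pos_bdd_pos[OF g, of y] by simp
  qed (use integrable_kernel_mult[OF g] in auto)
  then show ?thesis by (simp add: kint_def)
qed

text \<open>One half of the Birkhoff--Hopf contraction: with \<open>I x = kint g' x / kint g x\<close>, integrating the
  hypothesis over \<open>y\<close> gives \<open>g' \<ge> m g\<close> for \<open>m = I x / exp L\<close>. The normalised kernels
  \<open>k x / kint g x\<close> are comparable up to the factor \<open>1 / B ^ 4\<close>, so integrating \<open>g' - m g \<ge> 0\<close>
  against them bounds \<open>I x'\<close> below by a convex combination of \<open>I x\<close> and \<open>m\<close>.\<close>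

lemma kint_contraction:
  assumes g: "pos_bdd N g" and g': "pos_bdd N g'"
    and ratio: "\<And>y y'. g' y * g y' \<le> exp L * (g y * g' y')"
  shows "kint g' x * kint g x' \<le> exp ((1 - 1 / B ^ 4) * L) * (kint g x * kint g' x')"
proof -
  define \<delta> where "\<delta> = 1 / B ^ 4"
  define m where "m = kint g' x / kint g x / exp L"
  have \<delta>: "0 < \<delta>" "\<delta> \<le> 1" using B_ge_1 by (auto simp: \<delta>_def)
  note pos = kint_pos[OF g] kint_pos[OF g'] and ints = integrable_kernel_mult[OF g] integrable_kernel_mult[OF g']
  have low: "m * g y' \<le> g' y'" for y'
  proof -
    have "g y' * kint g' x = (\<integral>y. k x y * g' y * g y' \<partial>N)"
      by (simp add: kint_def mult.commute)
    also have "\<dots> \<le> (\<integral>y. (exp L * g' y') * (k x y * g y) \<partial>N)"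
    proof (intro integral_mono)
      fix y
      show "k x y * g' y * g y' \<le> (exp L * g' y') * (k x y * g y)"
        using mult_left_mono[OF ratio[of y y'], of "k x y"] kernel_pos[of x y] by (simp add: mult_ac)
    qed (use ints in auto)
    also have "\<dots> = exp L * g' y' * kint g x" by (simp add: kint_def)
    finally show ?thesis using pos(1)[of x] by (simp add: m_def field_simps)
  qed
  have mpos: "0 \<le> m" using pos by (simp add: m_def less_imp_le)
  have "\<delta> * (kint g' x - m * kint g x) * kint g x' \<le> (kint g' x' - m * kint g x') * kint g x"
  proof -
    have pt: "1 / B\<^sup>2 * (k x y * (g' y - m * g y)) \<le> k x' y * (g' y - m * g y)" for y
      using mult_right_mono[OF kernel_compare[of x y x' y], of "g' y - m * g y"] low[of y] B_ge_1
      by (simp add: field_simps)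
    have ii: "integrable N (\<lambda>y. k x y * (g' y - m * g y))"
        "(\<integral>y. k x y * (g' y - m * g y) \<partial>N) = kint g' x - m * kint g x" for x
    proof -
      have e: "(\<lambda>y. k x y * (g' y - m * g y)) = (\<lambda>y. k x y * g' y - m * (k x y * g y))"
        by (auto simp: algebra_simps)
      show "integrable N (\<lambda>y. k x y * (g' y - m * g y))"
        unfolding e using ints by auto
      show "(\<integral>y. k x y * (g' y - m * g y) \<partial>N) = kint g' x - m * kint g x"
        unfolding e kint_def using ints by simp
    qed
    \<comment> \<open>Of the constant \<open>1 / B ^ 4\<close>, one factor
      \<open>1 / B\<^sup>2\<close> comes from comparing the kernels (fact \<open>1\<close>), the
      other from comparing the normalisations (fact \<open>2\<close>). Fact \<open>3\<close> gives
      the sign needed to multiply the two inequalities.\<close>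
    have 1: "1 / B\<^sup>2 * (kint g' x - m * kint g x) \<le> kint g' x' - m * kint g x'"
    proof -
      have "(\<integral>y. 1 / B\<^sup>2 * (k x y * (g' y - m * g y)) \<partial>N) \<le> (\<integral>y. k x' y * (g' y - m * g y) \<partial>N)"
        using pt ii by (intro integral_mono integrable_mult_right) auto
      then show ?thesis by (simp add: ii(2))
    qed
    have 2: "1 / B\<^sup>2 * kint g x' \<le> kint g x"
      using kint_compare[OF g, of x' x] B_ge_1 by (simp add: field_simps)
    have 3: "0 \<le> kint g' z - m * kint g z" for z
      unfolding ii(2)[symmetric] using low kernel_pos
      by (intro integral_nonneg_AE AE_I2) (simp add: less_imp_le)
    have "(1 / B\<^sup>2 * (kint g' x - m * kint g x)) * (1 / B\<^sup>2 * kint g x')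
        \<le> (kint g' x' - m * kint g x') * kint g x"
      using 1 2 3[of x'] pos(1)[of x'] by (intro mult_mono) (auto simp: less_imp_le)
    moreover have "(1 / B\<^sup>2 * (kint g' x - m * kint g x)) * (1 / B\<^sup>2 * kint g x')
        = \<delta> * (kint g' x - m * kint g x) * kint g x'"
      unfolding \<delta>_def by (simp add: power2_eq_square power4_eq_xxxx)
    ultimately show ?thesis by simp
  qed
  moreover have "m * (kint g x * kint g x') = exp (- L) * (kint g x' * kint g' x)"
    using pos(1)[of x] by (simp add: m_def exp_minus field_simps)
  ultimately have "\<delta> * (kint g' x * kint g x' - kint g' x * exp (- L) * kint g x')
      \<le> kint g' x' * kint g x - kint g' x * exp (- L) * kint g x'"
    by (simp add: algebra_simps)
  then have A: "(\<delta> + (1 - \<delta>) * exp (- L)) * (kint g' x * kint g x') \<le> kint g x * kint g' x'"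
    by (simp add: algebra_simps)
  \<comment> \<open>Convexity of \<open>exp\<close> replaces the convex combination of 1 and
    \<open>exp (- L)\<close> by a single exponential, so the bound \<open>L\<close> on the
    logarithmic oscillation shrinks by the factor \<open>1 - \<delta>\<close>.\<close>
  have "exp (- ((1 - \<delta>) * L)) \<le> \<delta> + (1 - \<delta>) * exp (- L)"
    using convex_onD[OF exp_convex, of "1 - \<delta>" 0 "- L"] \<delta> by simp
  then have "exp (- ((1 - \<delta>) * L)) * (kint g' x * kint g x') \<le> kint g x * kint g' x'"
    using A pos by (meson mult_right_mono order_trans less_imp_le mult_pos_pos)
  then show ?thesis
    unfolding \<delta>_def[symmetric] exp_minus by (simp add: divide_simps mult_ac)
qed

end

section \<open>The Sinkhorn iteration, its fixed point and the resulting scaling\<close>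

locale sinkhorn = N: bounded_kernel N k B + M: bounded_kernel M "\<lambda>y x. k x y" B
  for M :: "'a measure" and N :: "'b measure" and k :: "'a \<Rightarrow> 'b \<Rightarrow> real" and B :: real +
  assumes pair_measurable [measurable]: "case_prod k \<in> borel_measurable (M \<Otimes>\<^sub>M N)"
begin

sublocale pair: pair_prob_space M N ..

lemma pos_bdd_inverse_kint:
  assumes g: "pos_bdd N g"
  shows "pos_bdd M (\<lambda>x. 1 / N.kint g x)"
proof (rule pos_bddI)
  let ?K = "\<integral>y. g y \<partial>N"
  have K: "0 < ?K" by (rule N.integral_pos_bdd_pos[OF g])
  have [measurable]: "g \<in> borel_measurable N" by (rule pos_bdd_measurable[OF g])
  show "(\<lambda>x. 1 / N.kint g x) \<in> borel_measurable M"
    unfolding N.kint_def by measurable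
  show "0 < 1 / (B * ?K)" using K N.B_ge_1 by simp
  show "1 / (B * ?K) \<le> 1 / N.kint g x" for x
    using N.kint_upper[OF g, of x] N.kint_pos[OF g, of x] by (intro divide_left_mono) auto
  show "1 / N.kint g x \<le> B / ?K" for x
    using N.kint_lower[OF g, of x] N.kint_pos[OF g, of x] K N.B_ge_1 by (simp add: field_simps)
qed

text \<open>Exchanging the two measures lets facts of this locale about one half-step be reused for
  the half-step back.\<close>

lemma transposed: "sinkhorn N M (\<lambda>y x. k x y) B"
proof
  show "(\<lambda>(y, x). k x y) \<in> borel_measurable (N \<Otimes>\<^sub>M M)" by measurable
qed

text \<open>A full Sinkhorn update, rescaled to take the value 1 at \<open>y\<^sub>0\<close>.
  Hilbert's metric does not see scalar multiples; fixing the value at one point selects a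
  representative, so contraction of the metric can yield pointwise convergence.\<close>

definition step :: "'b \<Rightarrow> ('b \<Rightarrow> real) \<Rightarrow> 'b \<Rightarrow> real" where
  "step y\<^sub>0 g y = M.kint (\<lambda>x. 1 / N.kint g x) y\<^sub>0 / M.kint (\<lambda>x. 1 / N.kint g x) y"

text \<open>A step is a quotient of two values of one kernel integral, so
  \<open>kint_compare\<close> applies with constants independent of \<open>g\<close>. All iterates
  therefore obey the same bounds.\<close>

lemma step_bounds:
  assumes g: "pos_bdd N g"
  shows "1 / B\<^sup>2 \<le> step y\<^sub>0 g y" "step y\<^sub>0 g y \<le> B\<^sup>2"
  using M.kint_compare[OF pos_bdd_inverse_kint[OF g], of y y\<^sub>0]
    M.kint_compare[OF pos_bdd_inverse_kint[OF g], of y\<^sub>0 y]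
    M.kint_pos[OF pos_bdd_inverse_kint[OF g], of y] N.B_ge_1
  by (simp_all add: step_def field_simps)

lemma pos_bdd_step:
  assumes g: "pos_bdd N g"
  shows "pos_bdd N (step y\<^sub>0 g)"
proof (rule pos_bddI)
  have "pos_bdd N (\<lambda>y. 1 / M.kint (\<lambda>x. 1 / N.kint g x) y)"
    using sinkhorn.pos_bdd_inverse_kint[OF transposed pos_bdd_inverse_kint[OF g]] .
  then have "(\<lambda>y. M.kint (\<lambda>x. 1 / N.kint g x) y\<^sub>0 * (1 / M.kint (\<lambda>x. 1 / N.kint g x) y)) \<in> borel_measurable N"
    by (intro borel_measurable_times borel_measurable_const pos_bdd_measurable)
  then show "step y\<^sub>0 g \<in> borel_measurable N" by (simp add: step_def[abs_def])
  show "0 < 1 / B\<^sup>2" using N.B_ge_1 by simp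
qed (rule step_bounds[OF g])+

text \<open>Each half-step contributes one factor \<open>1 - 1 / B ^ 4\<close>, hence the square.
  Taking the reciprocal in between only swaps the two points that are compared.\<close>

lemma step_contraction:
  assumes g: "pos_bdd N g" and g': "pos_bdd N g'"
    and ratio: "\<And>y y'. g' y * g y' \<le> exp L * (g y * g' y')"
  shows "step y\<^sub>0 g' y * step y\<^sub>0 g y' \<le> exp ((1 - 1 / B ^ 4)\<^sup>2 * L) * (step y\<^sub>0 g y * step y\<^sub>0 g' y')"
proof -
  let ?q = "1 - 1 / B ^ 4"
  note ib = pos_bdd_inverse_kint[OF g] pos_bdd_inverse_kint[OF g']
  let ?f = "\<lambda>x. 1 / N.kint g x" and ?f' = "\<lambda>x. 1 / N.kint g' x"
  have "?f' x * ?f x' \<le> exp (?q * L) * (?f x * ?f' x')" for x x'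
    using N.kint_contraction[OF g g' ratio, of x' x] N.kint_pos[OF g] N.kint_pos[OF g']
    by (simp add: field_simps)
  from M.kint_contraction[OF ib this, of y' y]
  show ?thesis
    using M.kint_pos[OF ib(1)] M.kint_pos[OF ib(2)]
    by (simp add: step_def field_simps power2_eq_square)
qed

lemma kint_tendsto:
  assumes G: "\<And>n. pos_bdd N (G n)" and le: "\<And>n y. G n y \<le> b"
    and lim: "\<And>y. (\<lambda>n. G n y) \<longlonglongrightarrow> g y"
  shows "(\<lambda>n. N.kint (G n) x) \<longlonglongrightarrow> N.kint g x"
  unfolding N.kint_def
proof (rule integral_dominated_convergence)
  have [measurable]: "\<And>n. G n \<in> borel_measurable N" using G by (rule pos_bdd_measurable)
  have [measurable]: "g \<in> borel_measurable N"
    by (rule borel_measurable_LIMSEQ_real[OF lim]) auto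
  show "(\<lambda>y. k x y * g y) \<in> borel_measurable N" "\<And>n. (\<lambda>y. k x y * G n y) \<in> borel_measurable N"
    by measurable
  show "integrable N (\<lambda>y. B * b)" by simp
  show "AE y in N. (\<lambda>n. k x y * G n y) \<longlonglongrightarrow> k x y * g y" by (intro AE_I2 tendsto_intros lim)
  show "AE y in N. norm (k x y * G n y) \<le> B * b" for n
    using N.kernel_upper N.kernel_pos pos_bdd_pos[OF G] le N.B_ge_1
    by (intro AE_I2) (auto simp: abs_mult less_imp_le intro!: mult_mono)
qed

text \<open>Convergence is obtained pointwise: the increments of the logarithms of the iterates are
  dominated by a geometric series. The uniform bounds then allow dominated convergence inside both
  kernel integrals, so the limit is fixed by \<open>step\<close>.\<close>

lemma step_fixpoint:
  obtains g where "pos_bdd N g" "\<And>y. step y\<^sub>0 g y = g y"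
proof -
  define q where "q = (1 - 1 / B ^ 4)\<^sup>2"
  have B1: "1 / B ^ 4 > 0" "1 / B ^ 4 \<le> 1" using N.B_ge_1 by auto
  have q: "0 \<le> q" "q < 1" unfolding q_def abs_square_less_1 using B1 by (simp, linarith)
  \<comment> \<open>The sequence starts after one application of \<open>step\<close>, so that
    \<open>G 0\<close> too satisfies \<open>step_bounds\<close> and equals 1 at
    \<open>y\<^sub>0\<close>.\<close>
  define G where "G n = (step y\<^sub>0 ^^ Suc n) (\<lambda>_. 1)" for n
  have GS: "G (Suc n) = step y\<^sub>0 (G n)" for n by (simp add: G_def)
  have p0: "pos_bdd N (\<lambda>_. 1)" by (rule pos_bddI[of _ _ 1 1]) auto
  have pG: "pos_bdd N (G n)" for n
    by (induction n) (use pos_bdd_step p0 in \<open>auto simp: G_def\<close>)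
  have Gstep: "\<exists>g. pos_bdd N g \<and> G n = step y\<^sub>0 g" for n
    by (cases n) (use p0 pG GS in \<open>auto simp: G_def\<close>)
  then have bG: "1 / B\<^sup>2 \<le> G n y" "G n y \<le> B\<^sup>2" for n y
    using step_bounds by metis+
  have G0: "G n y\<^sub>0 = 1" for n
    using Gstep[of n] M.kint_pos[OF pos_bdd_inverse_kint, of _ y\<^sub>0] by (force simp: step_def)
  \<comment> \<open>The four values in the initial cross ratio all lie between
    \<open>1 / B\<^sup>2\<close> and \<open>B\<^sup>2\<close>, so the ratio is at most
    \<open>B ^ 8\<close>.\<close>
  define L where "L = 8 * ln B"
  have Bpos: "B > 0" using N.B_ge_1 by simp
  have expL: "exp L = B ^ 8"
    using exp_of_nat_mult[of 8 "ln B"] Bpos by (simp add: L_def)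
  have ratio: "G (Suc n) y * G n y' \<le> exp (q ^ n * L) * (G n y * G (Suc n) y')" for n y y'
  proof (induction n arbitrary: y y')
    case 0
    have "G (Suc 0) y * G 0 y' \<le> B\<^sup>2 * B\<^sup>2"
      using bG pos_bdd_pos[OF pG] by (intro mult_mono) (auto simp: less_imp_le)
    also have "\<dots> = exp L * (1 / B\<^sup>2 * (1 / B\<^sup>2))" using Bpos by (simp add: expL field_simps)
    also have "\<dots> \<le> exp L * (G 0 y * G (Suc 0) y')"
      using bG pos_bdd_pos[OF pG] by (intro mult_left_mono mult_mono) (auto simp: less_imp_le)
    finally show ?case by simp
  next
    case (Suc n)
    from step_contraction[OF pG pG Suc]
    show ?case by (simp add: GS q_def mult.assoc)
  qed
  \<comment> \<open>Taking \<open>y\<^sub>0\<close> as one of the two points, where all iterates are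
    1, turns the bound on cross ratios into a bound on the increment at a single point.\<close>
  have step_ln: "\<bar>ln (G (Suc n) y) - ln (G n y)\<bar> \<le> q ^ n * L" for n y
  proof -
    note p = pos_bdd_pos[OF pG, of n y] pos_bdd_pos[OF pG, of "Suc n" y]
    have "ln (G (Suc n) y) \<le> ln (exp (q ^ n * L) * G n y)"
      using ratio[of n y y\<^sub>0] p by (simp add: G0)
    moreover have "ln (G n y) \<le> ln (exp (q ^ n * L) * G (Suc n) y)"
      using ratio[of n y\<^sub>0 y] p by (simp add: G0)
    ultimately show ?thesis using p by (simp add: ln_mult)
  qed
  define l where "l y = lim (\<lambda>n. ln (G n y))" for y
  have lim_ln: "(\<lambda>n. ln (G n y)) \<longlonglongrightarrow> l y" for y
  proof -
    have "summable (\<lambda>n. ln (G (Suc n) y) - ln (G n y))"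
    proof (rule summable_comparison_test')
      show "summable (\<lambda>n. q ^ n * L)" using q by (intro summable_mult2 summable_geometric) auto
    qed (use step_ln in auto)
    then have "convergent (\<lambda>n. \<Sum>i<n. ln (G (Suc i) y) - ln (G i y))"
      by (simp add: summable_iff_convergent)
    then have "convergent (\<lambda>n. ln (G n y) - ln (G 0 y))" by (simp only: sum_lessThan_telescope[of "\<lambda>n. ln (G n y)"])
    then have "convergent (\<lambda>n. ln (G n y) - ln (G 0 y) + ln (G 0 y))"
      by (intro convergent_add convergent_const)
    then show ?thesis by (simp add: l_def convergent_LIMSEQ_iff)
  qed
  define g where "g y = exp (l y)" for y
  have lim: "(\<lambda>n. G n y) \<longlonglongrightarrow> g y" for y
    using tendsto_exp[OF lim_ln[of y]] pos_bdd_pos[OF pG] by (simp add: g_def)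
  have pg: "pos_bdd N g"
  proof (rule pos_bddI)
    show "g \<in> borel_measurable N"
      by (rule borel_measurable_LIMSEQ_real[OF lim pos_bdd_measurable[OF pG]])
    show "1 / B\<^sup>2 \<le> g y" "g y \<le> B\<^sup>2" for y
      using bG by (auto intro!: LIMSEQ_le_const[OF lim] LIMSEQ_le_const2[OF lim])
    show "0 < 1 / B\<^sup>2" using Bpos by simp
  qed
  have limN: "(\<lambda>n. 1 / N.kint (G n) x) \<longlonglongrightarrow> 1 / N.kint g x" for x
    using N.kint_pos[OF pg, of x]
    by (intro tendsto_intros kint_tendsto[OF pG bG(2) lim]) auto
  \<comment> \<open>The dominating constant for the second half-step: the mass of \<open>G n\<close>
    is at least \<open>1 / B\<^sup>2\<close>, and the kernel costs one more factor
    \<open>B\<close>.\<close>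
  have upN: "1 / N.kint (G n) x \<le> B ^ 3" for n x
  proof -
    have "1 / B\<^sup>2 / B \<le> (\<integral>y. G n y \<partial>N) / B"
      using bG N.integrable_pos_bdd[OF pG] Bpos
      by (intro divide_right_mono N.integral_ge_const) auto
    also have "\<dots> \<le> N.kint (G n) x" by (rule N.kint_lower[OF pG])
    finally show ?thesis using N.kint_pos[OF pG, of n x] Bpos
      by (simp add: field_simps power3_eq_cube power2_eq_square)
  qed
  have limM: "(\<lambda>n. M.kint (\<lambda>x. 1 / N.kint (G n) x) y) \<longlonglongrightarrow> M.kint (\<lambda>x. 1 / N.kint g x) y" for y
    by (rule sinkhorn.kint_tendsto[OF transposed pos_bdd_inverse_kint[OF pG] upN limN])
  have "(\<lambda>n. G (Suc n) y) \<longlonglongrightarrow> step y\<^sub>0 g y" for y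
    unfolding GS step_def using M.kint_pos[OF pos_bdd_inverse_kint[OF pg], of y]
    by (intro tendsto_intros limM) auto
  then have "step y\<^sub>0 g y = g y" for y
    using LIMSEQ_unique[OF _ LIMSEQ_Suc[OF lim]] by blast
  then show thesis using pg that by blast
qed

text \<open>A fixed point of the normalised step solves the second equation only up to a constant
  \<open>c\<close>. Both kernel integrals come from the same function
  \<open>f x * k x y * g y\<close>; by Fubini its total mass is \<open>c\<close> as well as
  1.\<close>

lemma scaling:
  obtains f g where "pos_bdd M f" "pos_bdd N g"
    "\<And>x. f x * N.kint g x = 1" "\<And>y. g y * M.kint f y = 1"
proof -
  \<comment> \<open>\<open>undefined\<close> stands for an arbitrary base point; the value of
    \<open>M.kint f\<close> there becomes the constant \<open>c\<close>.\<close>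
  obtain g where g: "pos_bdd N g" and fp: "\<And>y. step undefined g y = g y"
    using step_fixpoint by blast
  define f where "f x = 1 / N.kint g x" for x
  have f: "pos_bdd M f" using pos_bdd_inverse_kint[OF g] by (simp add: f_def[abs_def])
  define c where "c = M.kint f undefined"
  have fg: "f x * N.kint g x = 1" for x using N.kint_pos[OF g, of x] by (simp add: f_def)
  have gf: "g y * M.kint f y = c" for y
    using fp[of y] M.kint_pos[OF f, of y] by (simp add: step_def f_def[symmetric] c_def field_simps)
  obtain bf bg where b: "\<And>x. f x \<le> bf" "\<And>y. g y \<le> bg" "0 < bf" "0 < bg"
    using f g unfolding pos_bdd_def by blast
  have [measurable]: "f \<in> borel_measurable M" "g \<in> borel_measurable N"
    using f g by (auto simp: pos_bdd_measurable)
  have "integrable (M \<Otimes>\<^sub>M N) (\<lambda>(x, y). f x * k x y * g y)"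
    using b pos_bdd_pos[OF f] pos_bdd_pos[OF g] N.kernel_upper N.kernel_pos N.B_ge_1
    by (intro pair.integrable_const_bound[of _ "bf * B * bg"] AE_I2)
       (auto simp: abs_mult less_imp_le split_beta intro!: mult_mono)
  from pair.Fubini_integral[OF this]
  have "(\<integral>y. g y * M.kint f y \<partial>N) = (\<integral>x. f x * N.kint g x \<partial>M)"
    by (simp add: M.kint_def N.kint_def mult_ac flip: integral_mult_right_zero)
  then have "c = 1" by (simp add: fg gf N.prob_space M.prob_space)
  then show thesis using that[OF f g fg] gf by simp
qed

lemma log_scaling:
  obtains \<phi> \<psi> where "\<phi> \<in> borel_measurable M" "\<psi> \<in> borel_measurable N"
    "\<And>x. \<bar>\<phi> x\<bar> \<le> 3 / 2 * ln B" "\<And>y. \<bar>\<psi> y\<bar> \<le> 3 / 2 * ln B"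
    "\<And>x. (\<integral>y. k x y * exp (\<phi> x + \<psi> y) \<partial>N) = 1"
    "\<And>y. (\<integral>x. k x y * exp (\<phi> x + \<psi> y) \<partial>M) = 1"
proof -
  obtain f g where f: "pos_bdd M f" and g: "pos_bdd N g"
    and fg: "\<And>x. f x * N.kint g x = 1" and gf: "\<And>y. g y * M.kint f y = 1"
    using scaling by blast
  have [measurable]: "f \<in> borel_measurable M" "g \<in> borel_measurable N"
    using f g by (auto simp: pos_bdd_measurable)
  define J K where "J = (\<integral>x. f x \<partial>M)" and "K = (\<integral>y. g y \<partial>N)"
  have JK: "0 < J" "0 < K"
    unfolding J_def K_def by (rule M.integral_pos_bdd_pos[OF f] N.integral_pos_bdd_pos[OF g])+
  have B: "0 < B" using N.B_ge_1 by simp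
  note pf = pos_bdd_pos[OF f] and pg = pos_bdd_pos[OF g]
  have "f x = 1 / N.kint g x" for x using fg[of x] N.kint_pos[OF g, of x] by (simp add: field_simps)
  then have f_bounds: "1 / (B * K) \<le> f x" "f x \<le> B / K" for x
    using N.kint_upper[OF g, of x] N.kint_lower[OF g, of x] N.kint_pos[OF g, of x] JK B
    by (simp_all add: K_def[symmetric] field_simps)
  have "g y = 1 / M.kint f y" for y using gf[of y] M.kint_pos[OF f, of y] by (simp add: field_simps)
  then have g_bounds: "1 / (B * J) \<le> g y" "g y \<le> B / J" for y
    using M.kint_upper[OF f, of y] M.kint_lower[OF f, of y] M.kint_pos[OF f, of y] JK B
    by (simp_all add: J_def[symmetric] field_simps)
  \<comment> \<open>Averaging the bounds on \<open>f\<close> over \<open>M\<close> puts its mass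
    \<open>J\<close> within a factor \<open>B\<close> of \<open>1 / K\<close>, which controls
    \<open>ln J + ln K\<close>.\<close>
  have J_bounds: "1 / (B * K) \<le> J" "J \<le> B / K"
    unfolding J_def using f_bounds M.integrable_pos_bdd[OF f]
    by (auto intro!: M.integral_ge_const M.integral_le_const)
  have ln_bounds: "\<bar>ln z + ln s\<bar> \<le> ln B" if "1 / (B * s) \<le> z" "z \<le> B / s" "0 < s" "0 < z" for s z :: real
  proof -
    have "ln (1 / (B * s)) \<le> ln z" "ln z \<le> ln (B / s)"
      using that B by auto
    then show ?thesis using that B by (simp add: ln_div ln_mult)
  qed
  \<comment> \<open>With this shift, \<open>\<phi>\<close> is
    \<open>(ln f + ln K) - (ln J + ln K) / 2\<close> and \<open>\<psi>\<close> is
    \<open>(ln g + ln J) - (ln J + ln K) / 2\<close>. The first brackets are bounded by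
    \<open>ln B\<close>, the halves by \<open>ln B / 2\<close>; this is the origin of
    \<open>3 / 2\<close>.\<close>
  define \<phi> \<psi> where "\<phi> x = ln (f x) + (ln K - ln J) / 2" and "\<psi> y = ln (g y) - (ln K - ln J) / 2" for x y
  have exp_sum: "exp (\<phi> x + \<psi> y) = f x * g y" for x y
    using pf[of x] pg[of y] by (simp add: \<phi>_def \<psi>_def exp_add)
  show thesis
  proof
    show "\<phi> \<in> borel_measurable M" "\<psi> \<in> borel_measurable N"
      unfolding \<phi>_def[abs_def] \<psi>_def[abs_def] by measurable
    have JK_bound: "\<bar>ln J + ln K\<bar> \<le> ln B" using ln_bounds[OF J_bounds] JK by auto
    show "\<bar>\<phi> x\<bar> \<le> 3 / 2 * ln B" for x
      using ln_bounds[OF f_bounds[of x] JK(2) pf] JK_bound unfolding \<phi>_def by argo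
    show "\<bar>\<psi> y\<bar> \<le> 3 / 2 * ln B" for y
      using ln_bounds[OF g_bounds[of y] JK(1) pg] JK_bound unfolding \<psi>_def by argo
    show "(\<integral>y. k x y * exp (\<phi> x + \<psi> y) \<partial>N) = 1" for x
      using fg[of x] by (simp add: exp_sum N.kint_def mult_ac flip: integral_mult_right_zero)
    show "(\<integral>x. k x y * exp (\<phi> x + \<psi> y) \<partial>M) = 1" for y
      using gf[of y] by (simp add: exp_sum M.kint_def mult_ac flip: integral_mult_right_zero)
  qed
qed

end

section \<open>Extended-real integrals on \<open>L_exp\<close>\<close>

lemma ereal_integral_ereal:
  assumes "integrable M w"
  shows "ereal_integral M (\<lambda>x. ereal (w x)) = ereal (\<integral>x. w x \<partial>M)"
proof -
  have fin: "(\<integral>\<^sup>+x. ennreal (w x) \<partial>M) \<noteq> \<infinity>" "(\<integral>\<^sup>+x. ennreal (- w x) \<partial>M) \<noteq> \<infinity>"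
    using assms by (auto simp: real_integrable_def)
  have "enn2ereal P - enn2ereal Q = ereal (enn2real P - enn2real Q)" if "P \<noteq> \<infinity>" "Q \<noteq> \<infinity>" for P Q
    using that by (cases P; cases Q) (auto simp: enn2ereal_ennreal)
  from this[OF fin] show ?thesis
    unfolding ereal_integral_def real_lebesgue_integral_def[OF assms] by simp
qed

lemma ereal_integral_cong_AE:
  assumes "AE x in M. u x = v x"
  shows "ereal_integral M u = ereal_integral M v"
proof -
  have "(\<integral>\<^sup>+x. e2ennreal (u x) \<partial>M) = (\<integral>\<^sup>+x. e2ennreal (v x) \<partial>M)"
    "(\<integral>\<^sup>+x. e2ennreal (- u x) \<partial>M) = (\<integral>\<^sup>+x. e2ennreal (- v x) \<partial>M)"
    using assms by (auto intro!: nn_integral_cong_AE)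
  then show ?thesis by (simp add: ereal_integral_def)
qed

text \<open>Follows from \<open>t \<le> exp t\<close> at \<open>t = u / \<epsilon>\<close>. It
  guarantees that \<open>ereal_integral\<close> never meets the difference of two infinities on
  \<open>L_exp\<close>.\<close>

lemma L_exp_pos_part_finite:
  assumes u: "u \<in> L_exp \<epsilon> M" and "\<epsilon> > 0"
  shows "(\<integral>\<^sup>+x. e2ennreal (u x) \<partial>M) < \<infinity>"
proof -
  have [measurable]: "u \<in> borel_measurable M" using u by (simp add: L_exp_def)
  have "ennreal (1 / \<epsilon>) * e2ennreal t \<le> ereal_exp (t / ereal \<epsilon>)" for t
  proof (cases t)
    case (real r)
    have "r / \<epsilon> \<le> exp (r / \<epsilon>)" using exp_ge_add_one_self[of "r / \<epsilon>"] by linarith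
    moreover have "ennreal (1 / \<epsilon>) * ennreal r \<le> ennreal (r / \<epsilon>)"
      using \<open>\<epsilon> > 0\<close> by (cases "0 \<le> r") (auto simp: ennreal_mult[symmetric] ennreal_neg)
    ultimately show ?thesis using real \<open>\<epsilon> > 0\<close> by (auto intro: order_trans ennreal_leI)
  qed (use \<open>\<epsilon> > 0\<close> in \<open>auto simp: e2ennreal_neg\<close>)
  then have "(\<integral>\<^sup>+x. ennreal (1 / \<epsilon>) * e2ennreal (u x) \<partial>M) \<le> (\<integral>\<^sup>+x. ereal_exp (u x / ereal \<epsilon>) \<partial>M)"
    by (intro nn_integral_mono)
  also have "\<dots> < \<infinity>" using u by (simp add: L_exp_def)
  finally have "ennreal (1 / \<epsilon>) * (\<integral>\<^sup>+x. e2ennreal (u x) \<partial>M) < \<infinity>" by (simp add: nn_integral_cmult)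
  then show ?thesis using \<open>\<epsilon> > 0\<close> by (auto simp: ennreal_mult_less_top)
qed

text \<open>With the positive part under control, the negative part decides: either its integral is
  infinite, or \<open>u\<close> agrees almost everywhere with an integrable real function. This
  reduces the optimality proof to real integrals.\<close>

lemma L_exp_integral_cases:
  assumes u: "u \<in> L_exp \<epsilon> M" and "\<epsilon> > 0"
  obtains "ereal_integral M u = - \<infinity>"
  | w where "integrable M w" "AE x in M. u x = ereal (w x)"
      "ereal_integral M u = ereal (\<integral>x. w x \<partial>M)"
proof (cases "(\<integral>\<^sup>+x. e2ennreal (- u x) \<partial>M) = \<infinity>")
  case True
  then have "ereal_integral M u = - \<infinity>"
    using L_exp_pos_part_finite[OF assms] unfolding ereal_integral_def
    by (cases "\<integral>\<^sup>+x. e2ennreal (u x) \<partial>M") (auto simp: enn2ereal_ennreal)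
  then show thesis by (rule that)
next
  case False
  have [measurable]: "u \<in> borel_measurable M" using u by (simp add: L_exp_def)
  define w where "w x = real_of_ereal (u x)" for x
  have "AE x in M. e2ennreal (- u x) \<noteq> \<infinity>"
    using False by (intro nn_integral_noteq_infinite) auto
  then have ae: "AE x in M. u x = ereal (w x)"
  proof (rule AE_mp, intro AE_I2 impI)
    fix x assume "x \<in> space M" "e2ennreal (- u x) \<noteq> \<infinity>"
    moreover have "u x < \<infinity>" using u \<open>x \<in> space M\<close> by (simp add: L_exp_def)
    ultimately show "u x = ereal (w x)" by (cases "u x") (auto simp: w_def)
  qed
  have "(\<integral>\<^sup>+x. ennreal (w x) \<partial>M) = (\<integral>\<^sup>+x. e2ennreal (u x) \<partial>M)"
    "(\<integral>\<^sup>+x. ennreal (- w x) \<partial>M) = (\<integral>\<^sup>+x. e2ennreal (- u x) \<partial>M)"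
    using ae by (auto intro!: nn_integral_cong_AE)
  then have w: "integrable M w"
    using False L_exp_pos_part_finite[OF assms] by (simp add: real_integrable_def w_def[abs_def])
  show thesis
    using that(2)[OF w ae] ereal_integral_cong_AE[OF ae] ereal_integral_ereal[OF w] by simp
qed

lemma (in prob_space) bounded_in_L_exp:
  assumes [measurable]: "w \<in> borel_measurable M" and w: "\<And>x. \<bar>w x\<bar> \<le> b" and "\<epsilon> > 0"
  shows "(\<lambda>x. ereal (w x)) \<in> L_exp \<epsilon> M"
proof -
  have "exp (- b / \<epsilon>) \<le> exp (w x / \<epsilon>)" "exp (w x / \<epsilon>) \<le> exp (b / \<epsilon>)" for x
    using w[of x] \<open>\<epsilon> > 0\<close> divide_right_mono[of "- b" "w x" \<epsilon>] divide_right_mono[of "w x" b \<epsilon>]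
    by (auto simp: abs_le_iff)
  then have "(\<integral>\<^sup>+x. ennreal (exp (- b / \<epsilon>)) \<partial>M) \<le> (\<integral>\<^sup>+x. ennreal (exp (w x / \<epsilon>)) \<partial>M)"
    "(\<integral>\<^sup>+x. ennreal (exp (w x / \<epsilon>)) \<partial>M) \<le> (\<integral>\<^sup>+x. ennreal (exp (b / \<epsilon>)) \<partial>M)"
    by (intro nn_integral_mono ennreal_leI; simp only:)+
  then have "0 < (\<integral>\<^sup>+x. ennreal (exp (w x / \<epsilon>)) \<partial>M)" "(\<integral>\<^sup>+x. ennreal (exp (w x / \<epsilon>)) \<partial>M) < \<infinity>"
    by (auto simp: emeasure_space_1 intro: less_le_trans[of 0 "ennreal (exp (- b / \<epsilon>))"] le_less_trans)
  then show ?thesis using \<open>\<epsilon> > 0\<close> by (simp add: L_exp_def)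
qed

section \<open>Densities with given marginals, and separated sums on a product\<close>

lemma (in pair_prob_space) marginal_integral:
  fixes p :: "'a \<Rightarrow> 'b \<Rightarrow> real"
  assumes [measurable]: "case_prod p \<in> borel_measurable (M1 \<Otimes>\<^sub>M M2)"
    and nonneg: "\<And>x y. 0 \<le> p x y" and marginal: "\<And>x. (\<integral>y. p x y \<partial>M2) = 1"
    and w: "integrable M1 w"
  shows "integrable (M1 \<Otimes>\<^sub>M M2) (\<lambda>(x, y). p x y * w x)"
    and "(\<integral>z. (case z of (x, y) \<Rightarrow> p x y * w x) \<partial>(M1 \<Otimes>\<^sub>M M2)) = (\<integral>x. w x \<partial>M1)"
proof -
  have [measurable]: "w \<in> borel_measurable M1" using w by auto
  \<comment> \<open>A non-integrable function has Bochner integral 0, so the value 1 already forces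
    integrability.\<close>
  have p: "integrable M2 (p x)" for x using marginal[of x] not_integrable_integral_eq by fastforce
  show int: "integrable (M1 \<Otimes>\<^sub>M M2) (\<lambda>(x, y). p x y * w x)"
  proof (rule Fubini_integrable)
    show "integrable M1 (\<lambda>x. \<integral>y. norm (case (x, y) of (x, y) \<Rightarrow> p x y * w x) \<partial>M2)"
      using w nonneg marginal by (simp add: abs_mult)
  qed (use p in auto)
  show "(\<integral>z. (case z of (x, y) \<Rightarrow> p x y * w x) \<partial>(M1 \<Otimes>\<^sub>M M2)) = (\<integral>x. w x \<partial>M1)"
    using integral_fst[OF int] marginal by simp
qed

lemma exp_eq_one_plus_iff: "exp t = 1 + t \<longleftrightarrow> t = 0" for t :: real
  using ln_eq_minus_one[of "exp t"] by auto

text \<open>One good section, at \<open>x\<^sub>0\<close>, determines \<open>g\<close> almost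
  everywhere; comparing almost every other section with it gives \<open>f x = f x\<^sub>0\<close>.
  Such an \<open>x\<^sub>0\<close> exists because a probability space is not null.\<close>

lemma (in pair_prob_space) AE_sum_eq_0_imp_const:
  fixes f :: "'a \<Rightarrow> real" and g :: "'b \<Rightarrow> real"
  assumes "AE z in M1 \<Otimes>\<^sub>M M2. f (fst z) + g (snd z) = 0"
  obtains a where "AE x in M1. f x = a" "AE y in M2. g y = - a"
proof -
  have *: "AE x in M1. AE y in M2. f x + g y = 0"
    using AE_pair[OF assms] by simp
  then obtain x\<^sub>0 where x\<^sub>0: "AE y in M2. f x\<^sub>0 + g y = 0"
    using M1.ae_filter_bot eventually_happens by blast
  then have g: "AE y in M2. g y = - f x\<^sub>0" by eventually_elim simp
  have "AE x in M1. f x = f x\<^sub>0"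
    using *
  proof eventually_elim
    case (elim x)
    with x\<^sub>0 have "AE y in M2. f x = f x\<^sub>0" by eventually_elim simp
    then show ?case by simp
  qed
  then show thesis using g by (rule that)
qed

section \<open>Optimality of solutions of the Schroedinger system\<close>

locale schrodinger_system = pair_prob_space M1 M2 for M1 :: "'a measure" and M2 :: "'b measure" +
  fixes c :: "'a \<times> 'b \<Rightarrow> real" and \<epsilon> :: real and \<phi> :: "'a \<Rightarrow> real" and \<psi> :: "'b \<Rightarrow> real"
  assumes cost_measurable [measurable]: "c \<in> borel_measurable (M1 \<Otimes>\<^sub>M M2)"
    and eps_pos: "\<epsilon> > 0"
    and integrable_phi: "integrable M1 \<phi>" and integrable_psi: "integrable M2 \<psi>"
    and marginal1: "\<And>x. (\<integral>y. exp ((\<phi> x + \<psi> y - c (x, y)) / \<epsilon>) \<partial>M2) = 1"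
    and marginal2: "\<And>y. (\<integral>x. exp ((\<phi> x + \<psi> y - c (x, y)) / \<epsilon>) \<partial>M1) = 1"
begin

text \<open>The value of the functional at \<open>(\<phi>, \<psi>)\<close>: there the exponential
  term has total mass 1.\<close>

definition "opt = (\<integral>x. \<phi> x \<partial>M1) + (\<integral>y. \<psi> y \<partial>M2) - \<epsilon>"

definition p :: "'a \<Rightarrow> 'b \<Rightarrow> real" where
  "p x y = exp ((\<phi> x + \<psi> y - c (x, y)) / \<epsilon>)"

lemma phi_psi_measurable [measurable]: "\<phi> \<in> borel_measurable M1" "\<psi> \<in> borel_measurable M2"
  using integrable_phi integrable_psi by auto

lemma p_measurable [measurable]: "case_prod p \<in> borel_measurable (M1 \<Otimes>\<^sub>M M2)"
  unfolding p_def[abs_def] by measurable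

lemma p_pos: "0 < p x y" by (simp add: p_def)

text \<open>By the marginal equations, \<open>p\<close> is the density of a coupling of
  \<open>M1\<close> and \<open>M2\<close>, so weighting a function of one variable by
  \<open>p\<close> leaves its integral unchanged. This lets the linear terms of the functional be
  moved onto the product.\<close>

lemma integrable_p_fst:
  assumes "integrable M1 w"
  shows "integrable (M1 \<Otimes>\<^sub>M M2) (\<lambda>z. p (fst z) (snd z) * w (fst z))"
    and "(\<integral>z. p (fst z) (snd z) * w (fst z) \<partial>(M1 \<Otimes>\<^sub>M M2)) = (\<integral>x. w x \<partial>M1)"
  using marginal_integral[of p w] marginal1 assms p_pos
  by (auto simp: p_def[symmetric] less_imp_le split_beta')

lemma integrable_p_snd:
  assumes w: "integrable M2 w"
  shows "integrable (M1 \<Otimes>\<^sub>M M2) (\<lambda>z. p (fst z) (snd z) * w (snd z))"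
    and "(\<integral>z. p (fst z) (snd z) * w (snd z) \<partial>(M1 \<Otimes>\<^sub>M M2)) = (\<integral>y. w y \<partial>M2)"
proof -
  interpret swap: pair_prob_space M2 M1 ..
  have "(\<lambda>(y, x). p x y) \<in> borel_measurable (M2 \<Otimes>\<^sub>M M1)" by measurable
  then have *: "integrable (M2 \<Otimes>\<^sub>M M1) (\<lambda>(y, x). p x y * w y)"
    "(\<integral>z. (case z of (y, x) \<Rightarrow> p x y * w y) \<partial>(M2 \<Otimes>\<^sub>M M1)) = (\<integral>y. w y \<partial>M2)"
    using swap.marginal_integral[of "\<lambda>y x. p x y" w] marginal2 w p_pos
    by (auto simp: p_def[symmetric] less_imp_le)
  show int: "integrable (M1 \<Otimes>\<^sub>M M2) (\<lambda>z. p (fst z) (snd z) * w (snd z))"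
    using swap.integrable_product_swap[OF *(1)] by (simp add: split_beta')
  have [measurable]: "w \<in> borel_measurable M2" using w by auto
  have "(\<lambda>z. p (fst z) (snd z) * w (snd z)) \<in> borel_measurable (M1 \<Otimes>\<^sub>M M2)" using int by auto
  from integral_product_swap[OF this]
  show "(\<integral>z. p (fst z) (snd z) * w (snd z) \<partial>(M1 \<Otimes>\<^sub>M M2)) = (\<integral>y. w y \<partial>M2)"
    using *(2) by (simp add: split_beta')
qed

text \<open>Optimality by the tangent inequality \<open>e\<^sup>t \<ge> 1 + t\<close> at the Schroedinger potentials:
  the gap is the integral of \<open>p (e\<^sup>t - 1 - t)\<close>, where \<open>t = (w\<^sub>1 - \<phi> + w\<^sub>2 - \<psi>) / \<epsilon>\<close>.\<close>

lemma gap: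
  assumes w: "integrable M1 w\<^sub>1" "integrable M2 w\<^sub>2"
    and E: "integrable (M1 \<Otimes>\<^sub>M M2) (\<lambda>z. exp ((w\<^sub>1 (fst z) + w\<^sub>2 (snd z) - c z) / \<epsilon>))"
  defines "D \<equiv> (\<integral>x. w\<^sub>1 x \<partial>M1) + (\<integral>y. w\<^sub>2 y \<partial>M2)
      - \<epsilon> * (\<integral>z. exp ((w\<^sub>1 (fst z) + w\<^sub>2 (snd z) - c z) / \<epsilon>) \<partial>(M1 \<Otimes>\<^sub>M M2))"
  shows "D \<le> opt"
    and "D = opt \<Longrightarrow> AE z in M1 \<Otimes>\<^sub>M M2. (w\<^sub>1 (fst z) - \<phi> (fst z)) + (w\<^sub>2 (snd z) - \<psi> (snd z)) = 0"
proof -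
  let ?P = "M1 \<Otimes>\<^sub>M M2" and ?p = "\<lambda>z. p (fst z) (snd z)"
  let ?E = "\<lambda>z. exp ((w\<^sub>1 (fst z) + w\<^sub>2 (snd z) - c z) / \<epsilon>)"
  let ?t = "\<lambda>z. ((w\<^sub>1 (fst z) - \<phi> (fst z)) + (w\<^sub>2 (snd z) - \<psi> (snd z))) / \<epsilon>"
  let ?d = "\<lambda>z. ?p z * (exp (?t z) - (1 + ?t z))"
  \<comment> \<open>As \<open>p\<close> times \<open>exp t\<close> is the competitor's exponential
    term, the integrand splits into that term, the mass of \<open>p\<close>, and one-variable
    functions weighted by \<open>p\<close>, whose integrals the marginals provide.\<close>
  have d: "?d = (\<lambda>z. ?E z - ?p z * 1 - (?p z * (w\<^sub>1 (fst z) - \<phi> (fst z)) + ?p z * (w\<^sub>2 (snd z) - \<psi> (snd z))) / \<epsilon>)"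
  proof
    fix z
    have "?p z * exp (?t z) = ?E z"
      using eps_pos by (simp add: p_def exp_add[symmetric] add_divide_distrib[symmetric])
    then show "?d z = ?E z - ?p z * 1 - (?p z * (w\<^sub>1 (fst z) - \<phi> (fst z)) + ?p z * (w\<^sub>2 (snd z) - \<psi> (snd z))) / \<epsilon>"
      using eps_pos by (simp add: algebra_simps add_divide_distrib diff_divide_distrib)
  qed
  have diffs: "integrable M1 (\<lambda>x. w\<^sub>1 x - \<phi> x)" "integrable M2 (\<lambda>y. w\<^sub>2 y - \<psi> y)"
    using w integrable_phi integrable_psi by auto
  have one: "integrable ?P (\<lambda>z. ?p z * 1)" "(\<integral>z. ?p z * 1 \<partial>?P) = 1"
    using integrable_p_fst[of "\<lambda>_. 1"] by (simp_all add: M1.prob_space)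
  note ints = E one integrable_p_fst[OF diffs(1)] integrable_p_snd[OF diffs(2)]
  have int_d: "integrable ?P ?d" unfolding d
    by (intro Bochner_Integration.integrable_diff Bochner_Integration.integrable_add integrable_divide ints)
  have "(\<integral>z. ?d z \<partial>?P) = (\<integral>z. ?E z \<partial>?P) - 1 - ((\<integral>x. w\<^sub>1 x - \<phi> x \<partial>M1) + (\<integral>y. w\<^sub>2 y - \<psi> y \<partial>M2)) / \<epsilon>"
    unfolding d using ints by (simp del: mult_1_right)
  then have gap: "D = opt - \<epsilon> * (\<integral>z. ?d z \<partial>?P)"
    using eps_pos w integrable_phi integrable_psi by (simp add: D_def opt_def field_simps)
  have nonneg: "0 \<le> ?d z" for z
    using p_pos[of "fst z" "snd z"] exp_ge_add_one_self[of "?t z"] by simp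
  then have "0 \<le> (\<integral>z. ?d z \<partial>?P)" by (intro integral_nonneg_AE AE_I2)
  then show "D \<le> opt" using gap eps_pos by simp
  assume "D = opt"
  then have "(\<integral>z. ?d z \<partial>?P) = 0" using gap eps_pos by simp
  then have "AE z in ?P. ?d z = 0"
    using integral_nonneg_eq_0_iff_AE[OF int_d] nonneg by simp
  then show "AE z in ?P. (w\<^sub>1 (fst z) - \<phi> (fst z)) + (w\<^sub>2 (snd z) - \<psi> (snd z)) = 0"
  proof eventually_elim
    case (elim z)
    then have "exp (?t z) = 1 + ?t z" using p_pos[of "fst z" "snd z"] by simp
    then have "?t z = 0" by (simp only: exp_eq_one_plus_iff)
    then show ?case using eps_pos by simp
  qed
qed

text \<open>Passes from the extended-real functional to real integrals. The case split is essential: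
  for non-integrable \<open>E\<close> the Bochner integral would read 0, whereas the nonnegative
  integral is infinite and the functional is \<open>- \<infinity>\<close>.\<close>

lemma EK_real:
  assumes u: "AE x in M1. u x = ereal (w\<^sub>1 x)" "ereal_integral M1 u = ereal (\<integral>x. w\<^sub>1 x \<partial>M1)"
    and v: "AE y in M2. v y = ereal (w\<^sub>2 y)" "ereal_integral M2 v = ereal (\<integral>y. w\<^sub>2 y \<partial>M2)"
    and w: "integrable M1 w\<^sub>1" "integrable M2 w\<^sub>2"
    and [measurable]: "u \<in> borel_measurable M1" "v \<in> borel_measurable M2"
  defines "E \<equiv> \<lambda>z. exp ((w\<^sub>1 (fst z) + w\<^sub>2 (snd z) - c z) / \<epsilon>)"
  shows "EK_functional c M1 M2 \<epsilon> u v = (if integrable (M1 \<Otimes>\<^sub>M M2) E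
    then ereal ((\<integral>x. w\<^sub>1 x \<partial>M1) + (\<integral>y. w\<^sub>2 y \<partial>M2) - \<epsilon> * (\<integral>z. E z \<partial>(M1 \<Otimes>\<^sub>M M2))) else - \<infinity>)"
proof -
  let ?P = "M1 \<Otimes>\<^sub>M M2"
  have [measurable]: "w\<^sub>1 \<in> borel_measurable M1" "w\<^sub>2 \<in> borel_measurable M2" using w by auto
  have [measurable]: "E \<in> borel_measurable ?P" unfolding E_def by measurable
  have "AE x in M1. AE y in M2. u x = ereal (w\<^sub>1 x) \<and> v y = ereal (w\<^sub>2 y)"
    using u(1) by eventually_elim (use v(1) in auto)
  then have "AE z in ?P. u (fst z) = ereal (w\<^sub>1 (fst z)) \<and> v (snd z) = ereal (w\<^sub>2 (snd z))"
    by (intro AE_pair_measure) auto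
  then have Z: "(\<integral>\<^sup>+z. ereal_exp ((u (fst z) + v (snd z) - ereal (c z)) / ereal \<epsilon>) \<partial>?P) = (\<integral>\<^sup>+z. ennreal (E z) \<partial>?P)"
    by (intro nn_integral_cong_AE, eventually_elim) (use eps_pos in \<open>simp add: E_def\<close>)
  show ?thesis
  proof (cases "integrable ?P E")
    case True
    then have "(\<integral>\<^sup>+z. ennreal (E z) \<partial>?P) = ennreal (\<integral>z. E z \<partial>?P)"
      by (intro nn_integral_eq_integral) (auto simp: E_def)
    moreover have "0 \<le> (\<integral>z. E z \<partial>?P)" by (simp add: E_def)
    ultimately show ?thesis using True by (simp add: EK_functional_def Z u v enn2ereal_ennreal)
  next
    case False
    have "(\<integral>\<^sup>+z. ennreal (E z) \<partial>?P) = \<infinity>"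
    proof (rule ccontr)
      assume "(\<integral>\<^sup>+z. ennreal (E z) \<partial>?P) \<noteq> \<infinity>"
      then have "integrable ?P E" by (intro integrableI_nonneg) (auto simp: E_def less_top)
      with False show "False" by simp
    qed
    then show ?thesis using False eps_pos by (simp add: EK_functional_def Z u v)
  qed
qed

text \<open>If a linear term is \<open>- \<infinity>\<close>, so is the functional; otherwise
  \<open>gap\<close> applies to real representatives of \<open>u\<close> and \<open>v\<close>, and
  its equality case yields the constant shift.\<close>

lemma EK_le_opt:
  assumes u: "u \<in> L_exp \<epsilon> M1" and v: "v \<in> L_exp \<epsilon> M2"
  shows "EK_functional c M1 M2 \<epsilon> u v \<le> ereal opt"
    and "EK_functional c M1 M2 \<epsilon> u v = ereal opt \<Longrightarrow>
      \<exists>a. (AE x in M1. u x = ereal (\<phi> x + a)) \<and> (AE y in M2. v y = ereal (\<psi> y - a))"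
proof -
  have meas: "u \<in> borel_measurable M1" "v \<in> borel_measurable M2" using u v by (auto simp: L_exp_def)
  let ?EK = "EK_functional c M1 M2 \<epsilon> u v"
  have "?EK \<le> ereal opt \<and> (?EK = ereal opt \<longrightarrow>
      (\<exists>a. (AE x in M1. u x = ereal (\<phi> x + a)) \<and> (AE y in M2. v y = ereal (\<psi> y - a))))"
  proof (cases "ereal_integral M1 u = - \<infinity> \<or> ereal_integral M2 v = - \<infinity>")
    case True
    \<comment> \<open>No linear term is \<open>\<infinity>\<close> and the penalty is not
      \<open>- \<infinity>\<close>, so nothing can cancel the summand
      \<open>- \<infinity>\<close>.\<close>
    have "ereal_integral M1 u \<noteq> \<infinity>" "ereal_integral M2 v \<noteq> \<infinity>"
      using L_exp_integral_cases[OF u eps_pos] L_exp_integral_cases[OF v eps_pos] by (metis MInfty_neq_PInfty(1) PInfty_neq_ereal(1) uminus_ereal.simps(3))+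
    moreover have "ereal \<epsilon> * enn2ereal Z \<noteq> - \<infinity>" for Z
      using eps_pos enn2ereal_nonneg[of Z] by (cases "enn2ereal Z") auto
    ultimately have "?EK = - \<infinity>" using True
      unfolding EK_functional_def minus_ereal_def by (auto simp: ereal_plus_eq_MInfty ereal_uminus_eq_reorder)
    then show ?thesis by simp
  next
    case False
    obtain w\<^sub>1 where w1: "integrable M1 w\<^sub>1" "AE x in M1. u x = ereal (w\<^sub>1 x)"
        "ereal_integral M1 u = ereal (\<integral>x. w\<^sub>1 x \<partial>M1)"
      using L_exp_integral_cases[OF u eps_pos] False by metis
    obtain w\<^sub>2 where w2: "integrable M2 w\<^sub>2" "AE y in M2. v y = ereal (w\<^sub>2 y)"
        "ereal_integral M2 v = ereal (\<integral>y. w\<^sub>2 y \<partial>M2)"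
      using L_exp_integral_cases[OF v eps_pos] False by metis
    note EK = EK_real[OF w1(2,3) w2(2,3) w1(1) w2(1) meas]
    note gap = gap[OF w1(1) w2(1)]
    show ?thesis
    proof (intro conjI impI)
      show "?EK \<le> ereal opt" using EK gap(1) by auto
      assume "?EK = ereal opt"
      then have "AE z in M1 \<Otimes>\<^sub>M M2. (w\<^sub>1 (fst z) - \<phi> (fst z)) + (w\<^sub>2 (snd z) - \<psi> (snd z)) = 0"
        using EK gap(2) by (auto split: if_splits)
      from AE_sum_eq_0_imp_const[of "\<lambda>x. w\<^sub>1 x - \<phi> x" "\<lambda>y. w\<^sub>2 y - \<psi> y", OF this]
      obtain a where a: "AE x in M1. w\<^sub>1 x - \<phi> x = a" "AE y in M2. w\<^sub>2 y - \<psi> y = - a" by blast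
      have "AE x in M1. u x = ereal (\<phi> x + a)"
        using a(1) w1(2) by eventually_elim (auto simp: algebra_simps)
      moreover have "AE y in M2. v y = ereal (\<psi> y - a)"
        using a(2) w2(2) by eventually_elim (auto simp: algebra_simps)
      ultimately show "\<exists>a. (AE x in M1. u x = ereal (\<phi> x + a)) \<and> (AE y in M2. v y = ereal (\<psi> y - a))"
        by blast
    qed
  qed
  then show "?EK \<le> ereal opt" "?EK = ereal opt \<Longrightarrow>
      \<exists>a. (AE x in M1. u x = ereal (\<phi> x + a)) \<and> (AE y in M2. v y = ereal (\<psi> y - a))" by auto
qed

lemma EK_phi_psi: "EK_functional c M1 M2 \<epsilon> (\<lambda>x. ereal (\<phi> x)) (\<lambda>y. ereal (\<psi> y)) = ereal opt"
proof -
  have "integrable (M1 \<Otimes>\<^sub>M M2) (\<lambda>z. exp ((\<phi> (fst z) + \<psi> (snd z) - c z) / \<epsilon>))"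
    "(\<integral>z. exp ((\<phi> (fst z) + \<psi> (snd z) - c z) / \<epsilon>) \<partial>(M1 \<Otimes>\<^sub>M M2)) = 1"
    using integrable_p_fst[of "\<lambda>_. 1"] by (simp_all add: M1.prob_space p_def)
  then show ?thesis
    by (subst EK_real[of _ \<phi> _ \<psi>])
       (auto simp: opt_def ereal_integral_ereal integrable_phi integrable_psi)
qed

end

section \<open>Existence of bounded potentials and the conclusion\<close>

lemma schrodinger_potentials_exist:
  fixes c :: "'a \<times> 'b \<Rightarrow> real"
  assumes "prob_space M" "prob_space N" and c [measurable]: "c \<in> borel_measurable (M \<Otimes>\<^sub>M N)"
    and measurable_section: "\<And>x. (\<lambda>y. c (x, y)) \<in> borel_measurable N" "\<And>y. (\<lambda>x. c (x, y)) \<in> borel_measurable M"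
    and C: "\<And>z. \<bar>c z\<bar> \<le> C" and "\<epsilon> > 0"
  obtains \<phi> \<psi> where "schrodinger_system M N c \<epsilon> \<phi> \<psi>"
    "\<And>x. \<bar>\<phi> x\<bar> \<le> 3 / 2 * C" "\<And>y. \<bar>\<psi> y\<bar> \<le> 3 / 2 * C"
proof -
  interpret M: prob_space M by fact
  interpret N: prob_space N by fact
  interpret pair_prob_space M N ..
  \<comment> \<open>The Gibbs kernel of the cost. Multiplying the logarithmic scalings by
    \<open>\<epsilon>\<close> gives the potentials, and \<open>\<epsilon> * ln B = C\<close> turns
    their bound into \<open>3 / 2 * C\<close>.\<close>
  define k where "k x y = exp (- c (x, y) / \<epsilon>)" for x y
  define B where "B = exp (C / \<epsilon>)"
  have "0 \<le> C" using C[of undefined] by linarith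
  then have B: "1 \<le> B" using \<open>\<epsilon> > 0\<close> by (simp add: B_def)
  have k: "1 / B \<le> k x y" "k x y \<le> B" for x y
    using C[of "(x, y)"] \<open>\<epsilon> > 0\<close> divide_right_mono[of "- C" "- c (x, y)" \<epsilon>] divide_right_mono[of "- c (x, y)" C \<epsilon>]
    by (auto simp: k_def B_def abs_le_iff exp_minus[symmetric] simp flip: inverse_eq_divide)
  interpret S: sinkhorn M N k B
  proof
    show "k x \<in> borel_measurable N" "(\<lambda>x. k x y) \<in> borel_measurable M" for x y
      unfolding k_def[abs_def] using measurable_section by measurable
    show "case_prod k \<in> borel_measurable (M \<Otimes>\<^sub>M N)" unfolding k_def[abs_def] by measurable
  qed (use B k in auto)
  obtain \<phi> \<psi> where [measurable]: "\<phi> \<in> borel_measurable M" "\<psi> \<in> borel_measurable N"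
    and bounds: "\<And>x. \<bar>\<phi> x\<bar> \<le> 3 / 2 * ln B" "\<And>y. \<bar>\<psi> y\<bar> \<le> 3 / 2 * ln B"
    and eqs: "\<And>x. (\<integral>y. k x y * exp (\<phi> x + \<psi> y) \<partial>N) = 1" "\<And>y. (\<integral>x. k x y * exp (\<phi> x + \<psi> y) \<partial>M) = 1"
    using S.log_scaling by blast
  have kexp: "exp ((\<epsilon> * \<phi> x + \<epsilon> * \<psi> y - c (x, y)) / \<epsilon>) = k x y * exp (\<phi> x + \<psi> y)" for x y
    using \<open>\<epsilon> > 0\<close> by (simp add: k_def exp_add[symmetric] field_simps)
  have lnB: "\<epsilon> * (3 / 2 * ln B) = 3 / 2 * C" using \<open>\<epsilon> > 0\<close> by (simp add: B_def)
  have b: "\<bar>\<epsilon> * \<phi> x\<bar> \<le> 3 / 2 * C" "\<bar>\<epsilon> * \<psi> y\<bar> \<le> 3 / 2 * C" for x y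
    using mult_left_mono[OF bounds(1)[of x], of \<epsilon>] mult_left_mono[OF bounds(2)[of y], of \<epsilon>] \<open>\<epsilon> > 0\<close>
    by (simp_all only: lnB abs_mult abs_of_pos less_imp_le)
  show thesis
  proof
    show "schrodinger_system M N c \<epsilon> (\<lambda>x. \<epsilon> * \<phi> x) (\<lambda>y. \<epsilon> * \<psi> y)"
    proof
      show "integrable M (\<lambda>x. \<epsilon> * \<phi> x)" using b
        by (intro M.integrable_const_bound[of _ "3 / 2 * C"]) auto
      show "integrable N (\<lambda>y. \<epsilon> * \<psi> y)" using b
        by (intro N.integrable_const_bound[of _ "3 / 2 * C"]) auto
    qed (use eqs \<open>\<epsilon> > 0\<close> in \<open>auto simp: kexp\<close>)
  qed (rule b)+
qed

lemma L_infinityI: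
  assumes "f \<in> borel_measurable M" and f: "AE x in M. \<bar>f x\<bar> \<le> ereal b"
  shows "f \<in> L_infinity M"
proof -
  have "(\<lambda>x. \<bar>f x\<bar>) \<in> borel_measurable M" using assms(1) by measurable
  from esssup_I[OF this f] show ?thesis using assms(1) by (auto simp: L_infinity_def)
qed

theorem theorem1p2:
  fixes \<rho>\<^sub>1 :: "'a::polish_space measure"
    and \<rho>\<^sub>2 :: "'b::polish_space measure"
    and c :: "'a \<times> 'b \<Rightarrow> real"
    and \<epsilon> :: real
  assumes "c \<in> borel_measurable borel" and "bounded (range c)"
    and "prob_space \<rho>\<^sub>1" and "sets \<rho>\<^sub>1 = sets borel"
    and "prob_space \<rho>\<^sub>2" and "sets \<rho>\<^sub>2 = sets borel"
    and "\<epsilon> > 0"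
  shows "(\<exists>u\<^sub>0 v\<^sub>0. EK_maximizer c \<rho>\<^sub>1 \<rho>\<^sub>2 \<epsilon> u\<^sub>0 v\<^sub>0) \<and>
    (\<forall>u\<^sub>0 v\<^sub>0 u v. EK_maximizer c \<rho>\<^sub>1 \<rho>\<^sub>2 \<epsilon> u\<^sub>0 v\<^sub>0 \<and> EK_maximizer c \<rho>\<^sub>1 \<rho>\<^sub>2 \<epsilon> u v \<longrightarrow>
       (\<exists>a::real. (AE x in \<rho>\<^sub>1. u x = u\<^sub>0 x + ereal a) \<and> (AE y in \<rho>\<^sub>2. v y = v\<^sub>0 y - ereal a))) \<and>
    (\<forall>u\<^sub>0 v\<^sub>0. EK_maximizer c \<rho>\<^sub>1 \<rho>\<^sub>2 \<epsilon> u\<^sub>0 v\<^sub>0 \<longrightarrow>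
       u\<^sub>0 \<in> L_infinity \<rho>\<^sub>1 \<and> v\<^sub>0 \<in> L_infinity \<rho>\<^sub>2) \<and>
    (\<exists>u\<^sub>0 v\<^sub>0. EK_maximizer c \<rho>\<^sub>1 \<rho>\<^sub>2 \<epsilon> u\<^sub>0 v\<^sub>0 \<and>
       sup_norm u\<^sub>0 \<le> 3 / 2 * sup_norm (\<lambda>z. ereal (c z)) \<and>
       sup_norm v\<^sub>0 \<le> 3 / 2 * sup_norm (\<lambda>z. ereal (c z)))"
proof -
  obtain C' where C': "\<And>z. \<bar>c z\<bar> \<le> C'" using assms(2) by (auto simp: bounded_iff)
  have "sup_norm (\<lambda>z. ereal (c z)) \<le> ereal C'" using C' by (auto simp: sup_norm_def intro!: SUP_least)
  moreover have ge: "ereal \<bar>c z\<bar> \<le> sup_norm (\<lambda>z. ereal (c z))" for z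
    unfolding sup_norm_def by (rule SUP_upper2[of z]) auto
  moreover from ge[of undefined] have "sup_norm (\<lambda>z. ereal (c z)) \<noteq> - \<infinity>" by auto
  \<comment> \<open>The construction is run with the exact supremum \<open>C\<close> rather than
    some upper bound \<open>C'\<close>, as the claimed estimate is relative to the supremum.\<close>
  ultimately obtain C where C: "sup_norm (\<lambda>z. ereal (c z)) = ereal C"
    by (cases "sup_norm (\<lambda>z. ereal (c z))") auto
  then have cC: "\<bar>c z\<bar> \<le> C" for z using ge[of z] by simp
  \<comment> \<open>Polish spaces are second countable, so the product of the Borel sigma-algebras
    is the Borel sigma-algebra of the product.\<close>
  have sets_pair: "sets (\<rho>\<^sub>1 \<Otimes>\<^sub>M \<rho>\<^sub>2) = sets borel"
    using sets_pair_measure_cong[OF assms(4,6)] unfolding borel_prod .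
  have meas: "c \<in> borel_measurable (\<rho>\<^sub>1 \<Otimes>\<^sub>M \<rho>\<^sub>2)"
    using assms(1) by (simp add: measurable_cong_sets[OF sets_pair refl])
  have spaces: "space \<rho>\<^sub>1 = UNIV" "space \<rho>\<^sub>2 = UNIV"
    using sets_eq_imp_space_eq[OF assms(4)] sets_eq_imp_space_eq[OF assms(6)] by auto
  \<comment> \<open>Sections are measurable at every point of the type because both spaces are all
    of \<open>UNIV\<close>; the kernel locale quantifies over the whole type.\<close>
  have sections: "(\<lambda>y. c (x, y)) \<in> borel_measurable \<rho>\<^sub>2" "(\<lambda>x. c (x, y)) \<in> borel_measurable \<rho>\<^sub>1" for x y
    using measurable_Pair2[OF meas, of x] measurable_Pair1[OF meas, of y] by (auto simp: spaces)
  obtain \<phi> \<psi> where "schrodinger_system \<rho>\<^sub>1 \<rho>\<^sub>2 c \<epsilon> \<phi> \<psi>"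
    and bounds: "\<And>x. \<bar>\<phi> x\<bar> \<le> 3 / 2 * C" "\<And>y. \<bar>\<psi> y\<bar> \<le> 3 / 2 * C"
    using schrodinger_potentials_exist[OF assms(3,5) meas sections cC assms(7)] by blast
  then interpret schrodinger_system \<rho>\<^sub>1 \<rho>\<^sub>2 c \<epsilon> \<phi> \<psi> by simp
  let ?u = "\<lambda>x. ereal (\<phi> x)" and ?v = "\<lambda>y. ereal (\<psi> y)"
  have L: "?u \<in> L_exp \<epsilon> \<rho>\<^sub>1" "?v \<in> L_exp \<epsilon> \<rho>\<^sub>2"
    using M1.bounded_in_L_exp[OF _ bounds(1) assms(7)] M2.bounded_in_L_exp[OF _ bounds(2) assms(7)] by auto
  have SUP: "(SUP (u, v) \<in> L_exp \<epsilon> \<rho>\<^sub>1 \<times> L_exp \<epsilon> \<rho>\<^sub>2. EK_functional c \<rho>\<^sub>1 \<rho>\<^sub>2 \<epsilon> u v) = ereal opt"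
  proof (rule antisym)
    show "(SUP (u, v) \<in> L_exp \<epsilon> \<rho>\<^sub>1 \<times> L_exp \<epsilon> \<rho>\<^sub>2. EK_functional c \<rho>\<^sub>1 \<rho>\<^sub>2 \<epsilon> u v) \<le> ereal opt"
      using EK_le_opt(1) by (auto intro!: SUP_least)
    show "ereal opt \<le> (SUP (u, v) \<in> L_exp \<epsilon> \<rho>\<^sub>1 \<times> L_exp \<epsilon> \<rho>\<^sub>2. EK_functional c \<rho>\<^sub>1 \<rho>\<^sub>2 \<epsilon> u v)"
      using L EK_phi_psi by (intro SUP_upper2[of "(?u, ?v)"]) auto
  qed
  have maximizer: "EK_maximizer c \<rho>\<^sub>1 \<rho>\<^sub>2 \<epsilon> ?u ?v"
    unfolding EK_maximizer_def SUP using L EK_phi_psi by simp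
  \<comment> \<open>Every maximizer attains \<open>opt\<close> and is thus a shift of
    \<open>(\<phi>, \<psi>)\<close>. Subtracting two shifts gives uniqueness, and boundedness of the
    potentials carries over to any maximizer.\<close>
  have char: "\<exists>a. (AE x in \<rho>\<^sub>1. u x = ereal (\<phi> x + a)) \<and> (AE y in \<rho>\<^sub>2. v y = ereal (\<psi> y - a))"
    and L_max: "u \<in> L_exp \<epsilon> \<rho>\<^sub>1" "v \<in> L_exp \<epsilon> \<rho>\<^sub>2"
    if "EK_maximizer c \<rho>\<^sub>1 \<rho>\<^sub>2 \<epsilon> u v" for u v
    using that EK_le_opt(2) unfolding EK_maximizer_def SUP by blast+
  have sup: "sup_norm ?u \<le> 3 / 2 * sup_norm (\<lambda>z. ereal (c z))" "sup_norm ?v \<le> 3 / 2 * sup_norm (\<lambda>z. ereal (c z))"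
  proof -
    have e: "3 / 2 * ereal C = ereal (3 / 2 * C)"
      unfolding numeral_eq_ereal by simp
    show "sup_norm ?u \<le> 3 / 2 * sup_norm (\<lambda>z. ereal (c z))" "sup_norm ?v \<le> 3 / 2 * sup_norm (\<lambda>z. ereal (c z))"
      unfolding C e sup_norm_def by (rule SUP_least, simp, use bounds in simp)+
  qed
  show ?thesis
  proof (intro conjI allI impI)
    show "\<exists>u\<^sub>0 v\<^sub>0. EK_maximizer c \<rho>\<^sub>1 \<rho>\<^sub>2 \<epsilon> u\<^sub>0 v\<^sub>0" using maximizer by blast
    show "\<exists>u\<^sub>0 v\<^sub>0. EK_maximizer c \<rho>\<^sub>1 \<rho>\<^sub>2 \<epsilon> u\<^sub>0 v\<^sub>0 \<and>
       sup_norm u\<^sub>0 \<le> 3 / 2 * sup_norm (\<lambda>z. ereal (c z)) \<and>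
       sup_norm v\<^sub>0 \<le> 3 / 2 * sup_norm (\<lambda>z. ereal (c z))" using maximizer sup by blast
  next
    fix u\<^sub>0 v\<^sub>0 u v
    assume max: "EK_maximizer c \<rho>\<^sub>1 \<rho>\<^sub>2 \<epsilon> u\<^sub>0 v\<^sub>0 \<and> EK_maximizer c \<rho>\<^sub>1 \<rho>\<^sub>2 \<epsilon> u v"
    obtain a where a: "AE x in \<rho>\<^sub>1. u\<^sub>0 x = ereal (\<phi> x + a)" "AE y in \<rho>\<^sub>2. v\<^sub>0 y = ereal (\<psi> y - a)"
      using char[OF conjunct1[OF max]] by blast
    obtain b where b: "AE x in \<rho>\<^sub>1. u x = ereal (\<phi> x + b)" "AE y in \<rho>\<^sub>2. v y = ereal (\<psi> y - b)"
      using char[OF conjunct2[OF max]] by blast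
    have "AE x in \<rho>\<^sub>1. u x = u\<^sub>0 x + ereal (b - a)" using a(1) b(1) by eventually_elim simp
    moreover have "AE y in \<rho>\<^sub>2. v y = v\<^sub>0 y - ereal (b - a)" using a(2) b(2) by eventually_elim simp
    ultimately show "\<exists>a::real. (AE x in \<rho>\<^sub>1. u x = u\<^sub>0 x + ereal a) \<and> (AE y in \<rho>\<^sub>2. v y = v\<^sub>0 y - ereal a)"
      by blast
  next
    fix u\<^sub>0 v\<^sub>0
    assume max: "EK_maximizer c \<rho>\<^sub>1 \<rho>\<^sub>2 \<epsilon> u\<^sub>0 v\<^sub>0"
    obtain a where a: "AE x in \<rho>\<^sub>1. u\<^sub>0 x = ereal (\<phi> x + a)" "AE y in \<rho>\<^sub>2. v\<^sub>0 y = ereal (\<psi> y - a)"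
      using char[OF max] by blast
    have "\<bar>\<phi> x + a\<bar> \<le> 3 / 2 * C + \<bar>a\<bar>" "\<bar>\<psi> y - a\<bar> \<le> 3 / 2 * C + \<bar>a\<bar>" for x y
      using bounds(1)[of x] bounds(2)[of y] by linarith+
    then have "AE x in \<rho>\<^sub>1. \<bar>u\<^sub>0 x\<bar> \<le> ereal (3 / 2 * C + \<bar>a\<bar>)" "AE y in \<rho>\<^sub>2. \<bar>v\<^sub>0 y\<bar> \<le> ereal (3 / 2 * C + \<bar>a\<bar>)"
      using a by (auto elim!: eventually_mono)
    then show "u\<^sub>0 \<in> L_infinity \<rho>\<^sub>1" "v\<^sub>0 \<in> L_infinity \<rho>\<^sub>2"
      using L_max[OF max] by (auto simp: L_exp_def intro: L_infinityI)
  qed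
qed

end
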